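(* In the modified $T$-period game described in the context, under (A5), for any strategy of the seller, the buyer's optimal strategy is given by a threshold rule: at every buyer history $\hat h_t$ (consisting of the public history including the current period-$t$ price together with the buyer's realized values $\theta_1,\dots,\theta_t$), the optimal decision is $x_t=\mathbf{1}_{\theta_t\ge k_t}$, where the threshold $k_t$ depends only on the public history.
   Context: Modified game. A seller sells one nondurable good in each period $t\in\{1,\dots,T\}$ (cost $0$) to a buyer who privately observes $\theta_t$ at the beginning of period $t$. In each period $t$ in which she has not yet committed, the seller either sets a price $p_t$ for period $t$ only, or publicly commits to a sequence $(p_t,\dots,p_T)$ of prices for the items of periods $t,\dots,T$; the buyer then decides $x_t\in\{0,1\}$. Seller's payoff $\sum_t\delta^{t-1}x_tp_t$, buyer's payoff $\sum_t\delta^{t-1}x_t(\theta_t-p_t)$, $\delta\in(0,1]$. The seller's strategy maps public histories (past prices, commitments and purchase decisions) to distributions over actions. (A5) Log-concave AR(1): $\theta_1\sim F_1$, log-concave with bounded support $[\underline{\theta}_1,\overline{\theta}_1]\subset\mathbb{R}_+$ and density $f_1>0$ there; for $t\ge2$, $\theta_t=\alpha_t\theta_{t-1}+\epsilon_t$ with $\alpha_t\in(0,\frac1{2\delta})$ and $\epsilon_t$ independently drawn from a log-concave distribution $G_t$ with bounded support. *)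

theory Defs
  imports "HOL-Probability.Probability"
begin

text \<open>Modified T-period game of the paper, periods are numbered 1..T.

Seller's action in a period in which she has not yet committed:
  Spot p     -- price p for the current period only;
  Commit q   -- public commitment to the prices q s for the periods s = t..T
               (values of q at other indices are irrelevant).\<close>

datatype sact = Spot real | Commit "nat \<Rightarrow> real"

text \<open>Public history up to (and excluding) period t: a list of length t-1 whose
  i-th entry records the seller's action in period i+1 (None if she had already
  committed before, hence took no action) and the buyer's purchase decision.\<close>

type_synonym phist = "(sact option \<times> bool) list"

fun commit_prices :: "phist \<Rightarrow> (nat \<Rightarrow> real) option" where
  "commit_prices [] = None"
| "commit_prices ((Some (Commit q), x) # r) = Some q"
| "commit_prices (e # r) = commit_prices r"

definition committed :: "phist \<Rightarrow> bool" where
  "committed h \<longleftrightarrow> commit_prices h \<noteq> None"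

definition wf_hist :: "phist \<Rightarrow> bool" where
  "wf_hist h \<longleftrightarrow> (\<forall>i < length h. fst (h ! i) = None \<longleftrightarrow> committed (take i h))"

text \<open>Price of the current period t = length h + 1, given the public history h and
  the seller's current action ao (None if she has already committed).\<close>

definition cur_price :: "phist \<Rightarrow> sact option \<Rightarrow> real" where
  "cur_price h ao =
     (case commit_prices h of
        Some q \<Rightarrow> q (length h + 1)
      | None \<Rightarrow> (case ao of
                   Some (Spot p) \<Rightarrow> p
                 | Some (Commit q) \<Rightarrow> q (length h + 1)
                 | None \<Rightarrow> 0))"

text \<open>Expected (optimal) continuation value of the buyer after the public history
  h' (length t), given the realised values \<theta>s = [\<theta>_1,..,\<theta>_t]:
  \<theta>_{t+1} = \<alpha>_{t+1} \<theta>_t + \<epsilon>_{t+1},  \<epsilon>_{t+1} ~ G_{t+1} independent.\<close>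

definition contv :: "(nat \<Rightarrow> real) \<Rightarrow> (nat \<Rightarrow> real measure) \<Rightarrow> (phist \<Rightarrow> real list \<Rightarrow> real)
                     \<Rightarrow> phist \<Rightarrow> real list \<Rightarrow> real" where
  "contv \<alpha> G V h' \<theta>s =
     (\<integral>e. V h' (\<theta>s @ [\<alpha> (length h' + 1) * last \<theta>s + e]) \<partial>(G (length h' + 1)))"

text \<open>Buyer's payoff (from period t on, in period-t units) of decision x at the buyer
  history (h, ao, \<theta>s), when continuing optimally (continuation value V).\<close>

definition Qval :: "real \<Rightarrow> (nat \<Rightarrow> real) \<Rightarrow> (nat \<Rightarrow> real measure) \<Rightarrow> (phist \<Rightarrow> real list \<Rightarrow> real)
                    \<Rightarrow> phist \<Rightarrow> sact option \<Rightarrow> real list \<Rightarrow> bool \<Rightarrow> real" where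
  "Qval \<delta> \<alpha> G V h ao \<theta>s x =
     (if x then last \<theta>s - cur_price h ao else 0) + \<delta> * contv \<alpha> G V (h @ [(ao, x)]) \<theta>s"

text \<open>Buyer's optimal value (Bellman recursion) at the beginning of period
  t = length h + 1 after \<theta>_t has been observed, with m periods remaining,
  against the seller strategy \<sigma> (public history \<mapsto> distribution of actions).\<close>

primrec BV :: "real \<Rightarrow> (nat \<Rightarrow> real) \<Rightarrow> (nat \<Rightarrow> real measure) \<Rightarrow> (phist \<Rightarrow> sact measure)
               \<Rightarrow> nat \<Rightarrow> phist \<Rightarrow> real list \<Rightarrow> real" where
  "BV \<delta> \<alpha> G \<sigma> 0 h \<theta>s = 0"
| "BV \<delta> \<alpha> G \<sigma> (Suc m) h \<theta>s =
     (if committed h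
      then max (Qval \<delta> \<alpha> G (BV \<delta> \<alpha> G \<sigma> m) h None \<theta>s True)
               (Qval \<delta> \<alpha> G (BV \<delta> \<alpha> G \<sigma> m) h None \<theta>s False)
      else (\<integral>a. max (Qval \<delta> \<alpha> G (BV \<delta> \<alpha> G \<sigma> m) h (Some a) \<theta>s True)
                     (Qval \<delta> \<alpha> G (BV \<delta> \<alpha> G \<sigma> m) h (Some a) \<theta>s False) \<partial>(\<sigma> h)))"

definition buyer_optimal :: "nat \<Rightarrow> real \<Rightarrow> (nat \<Rightarrow> real) \<Rightarrow> (nat \<Rightarrow> real measure)
     \<Rightarrow> (phist \<Rightarrow> sact measure) \<Rightarrow> phist \<Rightarrow> sact option \<Rightarrow> real list \<Rightarrow> bool \<Rightarrow> bool" where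
  "buyer_optimal T \<delta> \<alpha> G \<sigma> h ao \<theta>s x \<longleftrightarrow>
     Qval \<delta> \<alpha> G (BV \<delta> \<alpha> G \<sigma> (T - length h - 1)) h ao \<theta>s (\<not> x)
       \<le> Qval \<delta> \<alpha> G (BV \<delta> \<alpha> G \<sigma> (T - length h - 1)) h ao \<theta>s x"

definition log_concave :: "(real \<Rightarrow> real) \<Rightarrow> bool" where
  "log_concave f \<longleftrightarrow> (\<forall>x. 0 \<le> f x) \<and>
     (\<forall>x y l. 0 < l \<and> l < 1 \<longrightarrow> f x powr l * f y powr (1 - l) \<le> f (l * x + (1 - l) * y))"

text \<open>Value histories [\<theta>_1,..,\<theta>_t] in the support: \<theta>_1 \<in> [lo,hi] and
  \<epsilon>_s = \<theta>_s - \<alpha>_s \<theta>_{s-1} \<in> [a_s, b_s] (outside of which the density of G_s vanishes).\<close>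

definition feasible_vals :: "real \<Rightarrow> real \<Rightarrow> (nat \<Rightarrow> real) \<Rightarrow> (nat \<Rightarrow> real) \<Rightarrow> (nat \<Rightarrow> real)
                              \<Rightarrow> real list \<Rightarrow> bool" where
  "feasible_vals lo hi \<alpha> a b \<theta>s \<longleftrightarrow> \<theta>s \<noteq> [] \<and> lo \<le> \<theta>s ! 0 \<and> \<theta>s ! 0 \<le> hi \<and>
     (\<forall>i. 1 \<le> i \<and> i < length \<theta>s \<longrightarrow>
        a (i + 1) \<le> \<theta>s ! i - \<alpha> (i + 1) * \<theta>s ! (i - 1) \<and>
        \<theta>s ! i - \<alpha> (i + 1) * \<theta>s ! (i - 1) \<le> b (i + 1))"

definition expectations_defined :: "nat \<Rightarrow> real \<Rightarrow> (nat \<Rightarrow> real) \<Rightarrow> (nat \<Rightarrow> real measure)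
     \<Rightarrow> (phist \<Rightarrow> sact measure) \<Rightarrow> real \<Rightarrow> real \<Rightarrow> (nat \<Rightarrow> real) \<Rightarrow> (nat \<Rightarrow> real) \<Rightarrow> bool" where
  "expectations_defined T \<delta> \<alpha> G \<sigma> lo hi a b \<longleftrightarrow>
     (\<forall>h ao \<theta>s x. wf_hist h \<and> length h < T \<and> (ao = None \<longleftrightarrow> committed h)
        \<and> feasible_vals lo hi \<alpha> a b \<theta>s \<and> length \<theta>s = length h + 1 \<longrightarrow>
        integrable (G (length h + 2))
          (\<lambda>e. BV \<delta> \<alpha> G \<sigma> (T - length h - 1) (h @ [(ao, x)])
                 (\<theta>s @ [\<alpha> (length h + 2) * last \<theta>s + e]))
      \<and> (\<not> committed h \<longrightarrow>
          integrable (\<sigma> h)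
            (\<lambda>a'. max (Qval \<delta> \<alpha> G (BV \<delta> \<alpha> G \<sigma> (T - length h - 1)) h (Some a') \<theta>s True)
                      (Qval \<delta> \<alpha> G (BV \<delta> \<alpha> G \<sigma> (T - length h - 1)) h (Some a') \<theta>s False))))"

end

theory Submission
  imports Defs
begin

(* By backward induction, the buyer's value BV is nondecreasing in the current value \<theta>_t with
   slope at most 2: buying contributes slope 1 today, and since \<theta>_{t+1} = \<alpha>_{t+1} \<theta>_t + \<epsilon>_{t+1},
   the discounted continuation contributes a slope between 0 and q = 2 \<delta> \<alpha>_{t+1} < 1.
   Hence the gain from buying has slope between 1 - q > 0 and 1 + q in \<theta>_t: it is strictly
   increasing and continuous, so it changes sign at a single threshold, the infimum of the values
   at which buying is optimal. *)

definition slope_between :: "real \<Rightarrow> real \<Rightarrow> ('a \<Rightarrow> real) \<Rightarrow> 'a set \<Rightarrow> ('a \<Rightarrow> real) \<Rightarrow> bool" where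
  "slope_between c K l S F \<longleftrightarrow>
     (\<forall>x\<in>S. \<forall>y\<in>S. l x \<le> l y \<longrightarrow>
        c * (l y - l x) \<le> F y - F x \<and> F y - F x \<le> K * (l y - l x))"

lemma slope_betweenI:
  assumes "\<And>x y. x \<in> S \<Longrightarrow> y \<in> S \<Longrightarrow> l x \<le> l y \<Longrightarrow>
             c * (l y - l x) \<le> F y - F x \<and> F y - F x \<le> K * (l y - l x)"
  shows "slope_between c K l S F"
  using assms unfolding slope_between_def by blast

lemma slope_betweenD:
  assumes "slope_between c K l S F" "x \<in> S" "y \<in> S" "l x \<le> l y"
  shows "c * (l y - l x) \<le> F y - F x" "F y - F x \<le> K * (l y - l x)"
  using assms unfolding slope_between_def by blast+

lemma slope_between_weaken:
  assumes "slope_between c K l S F" "c' \<le> c" "K \<le> K'"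
  shows "slope_between c' K' l S F"
proof (rule slope_betweenI)
  fix x y assume xy: "x \<in> S" "y \<in> S" "l x \<le> l y"
  then have "c' * (l y - l x) \<le> c * (l y - l x)" "K * (l y - l x) \<le> K' * (l y - l x)"
    using assms(2,3) by (simp_all add: mult_right_mono)
  with slope_betweenD[OF assms(1) xy]
  show "c' * (l y - l x) \<le> F y - F x \<and> F y - F x \<le> K' * (l y - l x)" by linarith
qed

lemma slope_between_add:
  assumes "slope_between c K l S F" "slope_between c' K' l S F'"
  shows "slope_between (c + c') (K + K') l S (\<lambda>x. F x + F' x)"
  using assms unfolding slope_between_def by (simp add: algebra_simps) (smt (verit))

lemma slope_between_diff:
  assumes "slope_between c K l S F" "slope_between c' K' l S F'"
  shows "slope_between (c - K') (K - c') l S (\<lambda>x. F x - F' x)"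
  using assms unfolding slope_between_def by (simp add: algebra_simps) (smt (verit))

lemma slope_between_scale:
  assumes "0 \<le> r" "slope_between c K l S F"
  shows "slope_between (r * c) (r * K) l S (\<lambda>x. r * F x)"
proof (rule slope_betweenI)
  fix x y assume xy: "x \<in> S" "y \<in> S" "l x \<le> l y"
  from mult_left_mono[OF slope_betweenD(1)[OF assms(2) xy] assms(1)]
       mult_left_mono[OF slope_betweenD(2)[OF assms(2) xy] assms(1)]
  show "r * c * (l y - l x) \<le> r * F y - r * F x \<and> r * F y - r * F x \<le> r * K * (l y - l x)"
    by (simp add: algebra_simps)
qed

lemma slope_between_max:
  assumes "slope_between c K l S F" "slope_between c K l S F'"
  shows "slope_between c K l S (\<lambda>x. max (F x) (F' x))"
  using assms unfolding slope_between_def max_def by (smt (verit))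

lemma slope_between_compose_affine:
  assumes "slope_between c K l S' F" "\<phi> ` S \<subseteq> S'" "0 \<le> r"
    and "\<And>x. x \<in> S \<Longrightarrow> l (\<phi> x) = r * l x + s"
  shows "slope_between (r * c) (r * K) l S (\<lambda>x. F (\<phi> x))"
proof (rule slope_betweenI)
  fix x y assume xy: "x \<in> S" "y \<in> S" "l x \<le> l y"
  have \<phi>: "\<phi> x \<in> S'" "\<phi> y \<in> S'" using assms(2) xy by auto
  have d: "l (\<phi> y) - l (\<phi> x) = r * (l y - l x)" using assms(4) xy by (simp add: algebra_simps)
  have "0 \<le> r * (l y - l x)" using assms(3) xy(3) by simp
  then have "l (\<phi> x) \<le> l (\<phi> y)" using d by linarith
  from slope_betweenD[OF assms(1) \<phi> this] d
  show "r * c * (l y - l x) \<le> F (\<phi> y) - F (\<phi> x) \<and> F (\<phi> y) - F (\<phi> x) \<le> r * K * (l y - l x)"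
    by (simp add: ac_simps)
qed

lemma (in prob_space) slope_between_integral:
  assumes "AE e in M. slope_between c K l S (\<lambda>x. F x e)"
    and "\<And>x. x \<in> S \<Longrightarrow> integrable M (F x)"
  shows "slope_between c K l S (\<lambda>x. \<integral>e. F x e \<partial>M)"
proof (rule slope_betweenI)
  fix x y assume xy: "x \<in> S" "y \<in> S" "l x \<le> l y"
  have int: "integrable M (\<lambda>e. F y e - F x e)" using assms(2) xy by simp
  have diff: "(\<integral>e. F y e \<partial>M) - (\<integral>e. F x e \<partial>M) = (\<integral>e. F y e - F x e \<partial>M)"
    using assms(2) xy by simp
  have "(\<integral>e. c * (l y - l x) \<partial>M) \<le> (\<integral>e. F y e - F x e \<partial>M)"
    using assms(1) xy by (intro integral_mono_AE[OF _ int]) (auto dest: slope_betweenD)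
  moreover have "(\<integral>e. F y e - F x e \<partial>M) \<le> (\<integral>e. K * (l y - l x) \<partial>M)"
    using assms(1) xy by (intro integral_mono_AE[OF int]) (auto dest: slope_betweenD)
  ultimately show "c * (l y - l x) \<le> (\<integral>e. F y e \<partial>M) - (\<integral>e. F x e \<partial>M) \<and>
                   (\<integral>e. F y e \<partial>M) - (\<integral>e. F x e \<partial>M) \<le> K * (l y - l x)"
    unfolding diff by (simp add: prob_space)
qed

lemma slope_between_increment_le:
  assumes "0 < c" "slope_between c K l S D" "x \<in> S" "y \<in> S"
  shows "l y - l x \<le> max 0 ((D y - D x) / c)"
proof (cases "l x \<le> l y")
  case True
  with slope_betweenD(1)[OF assms(2-4)] assms(1) have "l y - l x \<le> (D y - D x) / c"
    by (simp add: pos_le_divide_eq mult.commute)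
  then show ?thesis by linarith
qed simp

lemma slope_between_threshold:
  assumes c: "0 < c" and K: "0 < K" and D: "slope_between c K l S D"
  shows "\<exists>k. \<forall>x\<in>S. (k \<le> l x \<longrightarrow> 0 \<le> D x) \<and> (l x < k \<longrightarrow> D x \<le> 0)"
proof (cases "\<exists>x\<in>S. 0 \<le> D x")
  case False
  show ?thesis
  proof (cases "S = {}")
    case False
    then obtain x0 where x0: "x0 \<in> S" by blast
    have bound: "l y < l x0 + max 0 (- D x0 / c) + 1" if y: "y \<in> S" for y
    proof -
      have "(D y - D x0) / c \<le> - D x0 / c"
        using \<open>\<not> (\<exists>x\<in>S. 0 \<le> D x)\<close> y c by (intro divide_right_mono) auto
      then show ?thesis using slope_between_increment_le[OF c D x0 y] by linarith
    qed
    show ?thesis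
    proof (intro exI[of _ "l x0 + max 0 (- D x0 / c) + 1"] ballI conjI impI)
      fix y assume "y \<in> S" "l x0 + max 0 (- D x0 / c) + 1 \<le> l y"
      with bound show "0 \<le> D y" by fastforce
    next
      fix y assume "y \<in> S"
      with \<open>\<not> (\<exists>x\<in>S. 0 \<le> D x)\<close> show "D y \<le> 0" by auto
    qed
  qed simp
next
  case True
  then obtain x0 where x0: "x0 \<in> S" "0 \<le> D x0" by blast
  define P where "P = l ` {x \<in> S. 0 \<le> D x}"
  have "bdd_below P"
  proof (rule bdd_belowI)
    fix p assume "p \<in> P"
    then obtain y where y: "y \<in> S" "0 \<le> D y" "p = l y" unfolding P_def by blast
    have "(D x0 - D y) / c \<le> D x0 / c" using y(2) c by (intro divide_right_mono) auto
    then show "l x0 - max 0 (D x0 / c) \<le> p"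
      using slope_between_increment_le[OF c D y(1) x0(1)] y(3) by linarith
  qed
  define k where "k = Inf P"
  have "0 \<le> D x" if x: "x \<in> S" "k \<le> l x" for x
  proof (rule ccontr)
    assume "\<not> 0 \<le> D x"
    then have e: "0 < - D x / K" using K by (simp add: divide_neg_pos)
    have "P \<noteq> {}" using x0 unfolding P_def by blast
    then obtain p where "p \<in> P" "p < k + - D x / K"
      using cInf_less_iff[OF _ \<open>bdd_below P\<close>] e unfolding k_def by (metis less_add_same_cancel1)
    then obtain y where y: "y \<in> S" "0 \<le> D y" "l y < k + - D x / K"
      unfolding P_def by blast
    show False
    proof (cases "l y \<le> l x")
      case True
      have "0 \<le> c * (l x - l y)" using c True by simp
      with slope_betweenD(1)[OF D y(1) x(1) True] y(2) \<open>\<not> 0 \<le> D x\<close> show False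
        by linarith
    next
      case False
      have "K * (l y - l x) < K * (- D x / K)"
        using y(3) x(2) K by (intro mult_strict_left_mono) auto
      then have "K * (l y - l x) < - D x" using K by simp
      with slope_betweenD(2)[OF D x(1) y(1)] False y(2) show False by linarith
    qed
  qed
  moreover have "D x \<le> 0" if x: "x \<in> S" "l x < k" for x
  proof (rule ccontr)
    assume "\<not> D x \<le> 0"
    then have "l x \<in> P" unfolding P_def using x by auto
    then show False using cInf_lower[OF _ \<open>bdd_below P\<close>] x(2) unfolding k_def by fastforce
  qed
  ultimately show ?thesis by blast
qed

lemma AE_density_zero_outside:
  fixes f :: "real \<Rightarrow> real"
  assumes "f \<in> borel_measurable borel" "\<And>x. x < a \<or> b < x \<Longrightarrow> f x = 0"
  shows "AE x in density lborel (\<lambda>x. ennreal (f x)). a \<le> x \<and> x \<le> b"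
proof -
  have meas: "(\<lambda>x. ennreal (f x)) \<in> borel_measurable lborel" using assms(1) by measurable
  show ?thesis
    unfolding AE_density[OF meas] by (rule AE_I2) (use assms(2) in \<open>force simp: not_le\<close>)
qed

lemma feasible_vals_snoc:
  assumes "feasible_vals lo hi \<alpha> a b \<theta>s"
    and "a (length \<theta>s + 1) \<le> e" "e \<le> b (length \<theta>s + 1)"
  shows "feasible_vals lo hi \<alpha> a b (\<theta>s @ [\<alpha> (length \<theta>s + 1) * last \<theta>s + e])"
proof -
  have ne: "\<theta>s \<noteq> []" using assms(1) by (simp add: feasible_vals_def)
  then have "last \<theta>s = \<theta>s ! (length \<theta>s - 1)" by (simp add: last_conv_nth)
  then show ?thesis
    using assms ne unfolding feasible_vals_def
    by (auto simp: nth_append less_Suc_eq)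
qed

lemma wf_hist_snoc:
  assumes "wf_hist h" "ao = None \<longleftrightarrow> committed h"
  shows "wf_hist (h @ [(ao, x)])"
  using assms unfolding wf_hist_def by (auto simp: nth_append less_Suc_eq)

locale buyer_problem =
  fixes T :: nat and \<delta> :: real and \<alpha> :: "nat \<Rightarrow> real" and G :: "nat \<Rightarrow> real measure"
    and \<sigma> :: "phist \<Rightarrow> sact measure" and lo hi :: real and a b :: "nat \<Rightarrow> real"
  assumes delta_pos: "0 < \<delta>"
    and alpha: "\<And>t. 2 \<le> t \<Longrightarrow> 0 < \<alpha> t \<and> \<alpha> t < 1 / (2 * \<delta>)"
    and G_prob: "\<And>t. 2 \<le> t \<Longrightarrow> prob_space (G t)"
    and G_support: "\<And>t. 2 \<le> t \<Longrightarrow> AE e in G t. a t \<le> e \<and> e \<le> b t"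
    and sigma_prob: "\<And>h. prob_space (\<sigma> h)"
    and wd: "expectations_defined T \<delta> \<alpha> G \<sigma> lo hi a b"
begin

definition value_hists :: "nat \<Rightarrow> real list set" where
  "value_hists n = {\<theta>s. feasible_vals lo hi \<alpha> a b \<theta>s \<and> length \<theta>s = n}"

abbreviation Q :: "nat \<Rightarrow> phist \<Rightarrow> sact option \<Rightarrow> real list \<Rightarrow> bool \<Rightarrow> real" where
  "Q m \<equiv> Qval \<delta> \<alpha> G (BV \<delta> \<alpha> G \<sigma> m)"

lemma discounted_alpha_bounds:
  assumes "2 \<le> t"
  shows "0 < 2 * \<delta> * \<alpha> t" "2 * \<delta> * \<alpha> t < 1"
proof -
  have "\<alpha> t * (2 * \<delta>) < 1" using alpha[OF assms] delta_pos by (simp add: field_simps)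
  then show "2 * \<delta> * \<alpha> t < 1" by (simp add: ac_simps)
  show "0 < 2 * \<delta> * \<alpha> t" using alpha[OF assms] delta_pos by simp
qed

lemma integrable_continuation:
  assumes "wf_hist h" "length h < T" "ao = None \<longleftrightarrow> committed h" "\<theta>s \<in> value_hists (length h + 1)"
  shows "integrable (G (length h + 2))
           (\<lambda>e. BV \<delta> \<alpha> G \<sigma> (T - length h - 1) (h @ [(ao, x)]) (\<theta>s @ [\<alpha> (length h + 2) * last \<theta>s + e]))"
  using wd[unfolded expectations_defined_def, rule_format, of h ao \<theta>s x] assms
  unfolding value_hists_def by simp

lemma integrable_action_value:
  assumes "wf_hist h" "length h < T" "\<not> committed h" "\<theta>s \<in> value_hists (length h + 1)"
  shows "integrable (\<sigma> h)
           (\<lambda>a'. max (Q (T - length h - 1) h (Some a') \<theta>s True) (Q (T - length h - 1) h (Some a') \<theta>s False))"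
  \<comment> \<open>the requirement on the action value is stated for every action Some a'; any one serves\<close>
  using wd[unfolded expectations_defined_def, rule_format, of h "Some undefined" \<theta>s] assms
  unfolding value_hists_def by simp

lemma slope_contv:
  assumes "1 \<le> length h'"
    and V: "slope_between 0 L last (value_hists (length h' + 1)) (V h')"
    and int: "\<And>\<theta>s. \<theta>s \<in> value_hists (length h') \<Longrightarrow>
               integrable (G (length h' + 1)) (\<lambda>e. V h' (\<theta>s @ [\<alpha> (length h' + 1) * last \<theta>s + e]))"
  shows "slope_between 0 (\<alpha> (length h' + 1) * L) last (value_hists (length h')) (contv \<alpha> G V h')"
proof -
  define t where "t = length h' + 1"
  have t: "2 \<le> t" using assms(1) unfolding t_def by simp
  have slope_e: "slope_between 0 (\<alpha> t * L) last (value_hists (length h'))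
                   (\<lambda>\<theta>s. V h' (\<theta>s @ [\<alpha> t * last \<theta>s + e]))" if e: "a t \<le> e \<and> e \<le> b t" for e
  proof -
    have "(\<lambda>\<theta>s. \<theta>s @ [\<alpha> t * last \<theta>s + e]) ` value_hists (length h') \<subseteq> value_hists t"
    proof (rule image_subsetI)
      fix \<theta>s assume "\<theta>s \<in> value_hists (length h')"
      with feasible_vals_snoc[of lo hi \<alpha> a b \<theta>s e] e
      show "\<theta>s @ [\<alpha> t * last \<theta>s + e] \<in> value_hists t" unfolding value_hists_def t_def by simp
    qed
    from slope_between_compose_affine[OF V[folded t_def] this, of "\<alpha> t" e] alpha[OF t]
    show ?thesis by simp
  qed
  have "AE e in G t. slope_between 0 (\<alpha> t * L) last (value_hists (length h'))
                      (\<lambda>\<theta>s. V h' (\<theta>s @ [\<alpha> t * last \<theta>s + e]))"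
    using G_support[OF t] by (rule eventually_mono) (rule slope_e)
  then have "slope_between 0 (\<alpha> t * L) last (value_hists (length h'))
               (\<lambda>\<theta>s. \<integral>e. V h' (\<theta>s @ [\<alpha> t * last \<theta>s + e]) \<partial>G t)"
    using int by (intro prob_space.slope_between_integral[OF G_prob[OF t]]) (simp_all add: t_def)
  then show ?thesis unfolding t_def contv_def[abs_def] by simp
qed

lemma slope_Qval:
  assumes h: "wf_hist h" "length h < T" "ao = None \<longleftrightarrow> committed h"
    and V: "slope_between 0 2 last (value_hists (length h + 2))
              (BV \<delta> \<alpha> G \<sigma> (T - length h - 1) (h @ [(ao, x)]))"
  shows "slope_between (of_bool x) (of_bool x + 2 * \<delta> * \<alpha> (length h + 2)) last
           (value_hists (length h + 1)) (\<lambda>\<theta>s. Q (T - length h - 1) h ao \<theta>s x)"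
proof -
  let ?S = "value_hists (length h + 1)"
  have "slope_between 0 (\<alpha> (length h + 2) * 2) last ?S
          (contv \<alpha> G (BV \<delta> \<alpha> G \<sigma> (T - length h - 1)) (h @ [(ao, x)]))"
    using slope_contv[of "h @ [(ao, x)]" 2 "BV \<delta> \<alpha> G \<sigma> (T - length h - 1)"]
      V integrable_continuation[OF h] by simp
  from slope_between_scale[OF less_imp_le[OF delta_pos] this]
  have later: "slope_between 0 (2 * \<delta> * \<alpha> (length h + 2)) last ?S
                 (\<lambda>\<theta>s. \<delta> * contv \<alpha> G (BV \<delta> \<alpha> G \<sigma> (T - length h - 1)) (h @ [(ao, x)]) \<theta>s)"
    by (simp add: ac_simps)
  have now: "slope_between (of_bool x) (of_bool x) last ?S
               (\<lambda>\<theta>s. if x then last \<theta>s - cur_price h ao else 0)"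
    by (cases x) (simp_all add: slope_between_def)
  from slope_between_add[OF now later] show ?thesis unfolding Qval_def by simp
qed

lemma slope_BV:
  "wf_hist h \<Longrightarrow> length h + n = T \<Longrightarrow>
   slope_between 0 2 last (value_hists (length h + 1)) (BV \<delta> \<alpha> G \<sigma> n h)"
proof (induction n arbitrary: h)
  case 0
  then show ?case by (simp add: slope_between_def)
next
  case (Suc m)
  have m: "T - length h - 1 = m" "length h < T" using Suc.prems(2) by auto
  have Q: "slope_between 0 2 last (value_hists (length h + 1)) (\<lambda>\<theta>s. Q m h ao \<theta>s x)"
    if ao: "ao = None \<longleftrightarrow> committed h" for ao x
  proof -
    have "slope_between 0 2 last (value_hists (length h + 2)) (BV \<delta> \<alpha> G \<sigma> m (h @ [(ao, x)]))"
      using Suc.IH[OF wf_hist_snoc[OF Suc.prems(1) ao]] Suc.prems(2) by simp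
    from slope_Qval[OF Suc.prems(1) m(2) ao, unfolded m, OF this]
    show ?thesis
      by (rule slope_between_weaken) (use discounted_alpha_bounds(2)[of "length h + 2"] in auto)
  qed
  show ?case
  proof (cases "committed h")
    case True
    then have "BV \<delta> \<alpha> G \<sigma> (Suc m) h = (\<lambda>\<theta>s. max (Q m h None \<theta>s True) (Q m h None \<theta>s False))"
      by auto
    then show ?thesis using slope_between_max[OF Q Q] True by simp
  next
    case False
    then have "BV \<delta> \<alpha> G \<sigma> (Suc m) h =
                 (\<lambda>\<theta>s. \<integral>a'. max (Q m h (Some a') \<theta>s True) (Q m h (Some a') \<theta>s False) \<partial>\<sigma> h)"
      by auto
    moreover have "slope_between 0 2 last (value_hists (length h + 1))
        (\<lambda>\<theta>s. \<integral>a'. max (Q m h (Some a') \<theta>s True) (Q m h (Some a') \<theta>s False) \<partial>\<sigma> h)"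
      using Q False integrable_action_value[OF Suc.prems(1) m(2) False, unfolded m(1)]
      by (intro prob_space.slope_between_integral[OF sigma_prob] AE_I2 slope_between_max)
         (simp_all add: m)
    ultimately show ?thesis by simp
  qed
qed

lemma threshold_at_history:
  assumes h: "wf_hist h" "length h < T" "ao = None \<longleftrightarrow> committed h"
  shows "\<exists>k. \<forall>\<theta>s \<in> value_hists (length h + 1). buyer_optimal T \<delta> \<alpha> G \<sigma> h ao \<theta>s (k \<le> last \<theta>s)"
proof -
  define q where "q = 2 * \<delta> * \<alpha> (length h + 2)"
  have q: "0 < q" "q < 1" using discounted_alpha_bounds[of "length h + 2"] unfolding q_def by auto
  have slope_Q: "slope_between (of_bool x) (of_bool x + q) last (value_hists (length h + 1))
                   (\<lambda>\<theta>s. Q (T - length h - 1) h ao \<theta>s x)" for x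
    using slope_Qval[OF h] slope_BV[OF wf_hist_snoc[OF h(1) h(3)]] h(2) unfolding q_def by simp
  have "slope_between (1 - q) (1 + q) last (value_hists (length h + 1))
          (\<lambda>\<theta>s. Q (T - length h - 1) h ao \<theta>s True - Q (T - length h - 1) h ao \<theta>s False)"
    using slope_between_diff[OF slope_Q[of True] slope_Q[of False]] by simp
  from slope_between_threshold[OF _ _ this] q obtain k where k:
    "\<forall>\<theta>s \<in> value_hists (length h + 1).
       (k \<le> last \<theta>s \<longrightarrow> Q (T - length h - 1) h ao \<theta>s False \<le> Q (T - length h - 1) h ao \<theta>s True) \<and>
       (last \<theta>s < k \<longrightarrow> Q (T - length h - 1) h ao \<theta>s True \<le> Q (T - length h - 1) h ao \<theta>s False)"
    by auto
  show ?thesis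
  proof (intro exI[of _ k] ballI)
    fix \<theta>s assume "\<theta>s \<in> value_hists (length h + 1)"
    with k show "buyer_optimal T \<delta> \<alpha> G \<sigma> h ao \<theta>s (k \<le> last \<theta>s)"
      unfolding buyer_optimal_def by (cases "k \<le> last \<theta>s") auto
  qed
qed

end

theorem lemma5:
  fixes T :: nat and \<delta> :: real and \<alpha> :: "nat \<Rightarrow> real"
    and lo hi :: real and f1 :: "real \<Rightarrow> real" and F1 :: "real measure"
    and g :: "nat \<Rightarrow> real \<Rightarrow> real" and a b :: "nat \<Rightarrow> real" and G :: "nat \<Rightarrow> real measure"
    and \<sigma> :: "phist \<Rightarrow> sact measure"
  assumes T: "1 \<le> T"
    and delta: "0 < \<delta>" "\<delta> \<le> 1"
    and F1_def: "F1 = density lborel (\<lambda>x. ennreal (f1 x))" and F1_prob: "prob_space F1"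
    and f1_meas: "f1 \<in> borel_measurable borel" and f1_lc: "log_concave f1"
    and supp1: "0 \<le> lo" "lo < hi"
    and f1_pos: "\<And>x. lo \<le> x \<Longrightarrow> x \<le> hi \<Longrightarrow> 0 < f1 x"
    and f1_zero: "\<And>x. x < lo \<or> hi < x \<Longrightarrow> f1 x = 0"
    and alpha: "\<And>t. 2 \<le> t \<Longrightarrow> 0 < \<alpha> t \<and> \<alpha> t < 1 / (2 * \<delta>)"
    and G_def: "\<And>t. 2 \<le> t \<Longrightarrow> G t = density lborel (\<lambda>x. ennreal (g t x))"
    and G_prob: "\<And>t. 2 \<le> t \<Longrightarrow> prob_space (G t)"
    and g_meas: "\<And>t. 2 \<le> t \<Longrightarrow> g t \<in> borel_measurable borel"
    and g_lc: "\<And>t. 2 \<le> t \<Longrightarrow> log_concave (g t)"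
    and g_bdd: "\<And>t x. 2 \<le> t \<Longrightarrow> x < a t \<or> b t < x \<Longrightarrow> g t x = 0"
    and sigma_prob: "\<And>h. prob_space (\<sigma> h)"
    and wd: "expectations_defined T \<delta> \<alpha> G \<sigma> lo hi a b"
  shows "\<exists>k :: phist \<Rightarrow> sact option \<Rightarrow> real.
           \<forall>h ao \<theta>s. wf_hist h \<and> length h < T \<and> (ao = None \<longleftrightarrow> committed h)
              \<and> feasible_vals lo hi \<alpha> a b \<theta>s \<and> length \<theta>s = length h + 1 \<longrightarrow>
              buyer_optimal T \<delta> \<alpha> G \<sigma> h ao \<theta>s (k h ao \<le> last \<theta>s)"
proof -
  have G_support: "AE e in G t. a t \<le> e \<and> e \<le> b t" if "2 \<le> t" for t
    unfolding G_def[OF that]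
    by (rule AE_density_zero_outside[of "g t" "a t" "b t"]) (use g_meas g_bdd that in auto)
  interpret buyer_problem T \<delta> \<alpha> G \<sigma> lo hi a b
    using delta(1) alpha G_prob G_support sigma_prob wd by (rule buyer_problem.intro)
  have "\<exists>k. \<forall>\<theta>s. wf_hist h \<and> length h < T \<and> (ao = None \<longleftrightarrow> committed h)
              \<and> feasible_vals lo hi \<alpha> a b \<theta>s \<and> length \<theta>s = length h + 1 \<longrightarrow>
              buyer_optimal T \<delta> \<alpha> G \<sigma> h ao \<theta>s (k \<le> last \<theta>s)" for h ao
    using threshold_at_history[of h ao] unfolding value_hists_def
    by (cases "wf_hist h \<and> length h < T \<and> (ao = None \<longleftrightarrow> committed h)") auto
  then show ?thesis by metis
qed

end
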